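(* Let $\mathbb{F}$ be a field and let $A \in \mathbb{M}_{m,n}$, $B \in \mathbb{M}_{n,p}$, $C \in \mathbb{M}_{p,q}$ be matrices over $\mathbb{F}$. Then $$\operatorname{rank}(ABC) + \operatorname{rank}(B) = \operatorname{rank}(AB) + \operatorname{rank}(BC)$$ if and only if there exist matrices $X \in \mathbb{M}_{q,p}$ and $Y \in \mathbb{M}_{n,m}$ over $\mathbb{F}$ such that $$B = BCX + YAB.$$
   Context: $\mathbb{M}_{m,n}$ denotes the space of $m \times n$ matrices over the field $\mathbb{F}$. *)

theory Defs
  imports "HOL-Analysis.Analysis"
begin

end

theory Submission
  imports Defs
begin

text \<open>
  Since rank is defined as the dimension of the row space, pass to transposes, so that ranks become
  dimensions of ranges. Rank-nullity for \<open>A\<close> restricted to the ranges of \<open>B\<close> and \<open>BC\<close> shows that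
  the rank identity holds iff \<open>ker A \<inter> range B\<close> and \<open>ker A \<inter> range (BC)\<close> coincide. Given this, let
  \<open>G\<close> be a generalised inverse of \<open>AB\<close>: the columns of \<open>B - B G A B\<close> lie in \<open>ker A \<inter> range B\<close>,
  hence in \<open>range (BC)\<close>, so \<open>B - B G A B = B C X\<close> for some \<open>X\<close>.
\<close>

lemma range_matrix_vector_mult:
  fixes M :: "'a::field ^ 'n ^ 'm"
  shows "range ((*v) M) = vec.span (columns M)"
proof -
  have "M *v axis k 1 = column k M" for k
    by (simp add: vec_eq_iff matrix_vector_mult_def column_def axis_def if_distrib cong: if_cong)
  then have "(*v) M ` cart_basis = columns M"
    unfolding cart_basis_def columns_def Setcompr_eq_image by (simp add: image_image)
  then show ?thesis
    by (metis vec.linear_span_image matrix_vector_mul_linear_gen span_cart_basis)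
qed

lemma rank_eq_dim_range_transpose:
  fixes M :: "'a::field ^ 'n ^ 'm"
  shows "rank M = vec.dim (range ((*v) (transpose M)))"
  unfolding range_matrix_vector_mult by (simp add: row_rank_def_gen)

text \<open>Rank-nullity for the restriction of \<open>A\<close> to \<open>S\<close>. A linear right
  inverse \<open>g\<close> of this restriction embeds the image back into \<open>S\<close> as a
  complement of the kernel.\<close>

lemma dim_image_kernel:
  fixes A :: "'a::field ^ 'n ^ 'm"
  assumes S: "vec.subspace S"
  shows "vec.dim S = vec.dim ((*v) A ` S) + vec.dim (S \<inter> {x. A *v x = 0})"
proof -
  obtain g where g: "range g \<subseteq> S" and lg: "Vector_Spaces.linear (*s) (*s) g"
    and inv: "\<And>v. v \<in> (*v) A ` S \<Longrightarrow> A *v g v = v"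
    using vec.linear_exists_right_inverse_on[OF matrix_vector_mul_linear_gen S, of A] by blast
  let ?I = "(*v) A ` S" and ?K = "S \<inter> {x. A *v x = 0}"
  have I: "vec.subspace ?I"
    by (simp add: S vec.linear_subspace_image)
  have gI: "vec.subspace (g ` ?I)"
    by (rule vec.linear_subspace_image[OF lg I])
  have K: "vec.subspace ?K"
    using S by (auto simp: vec.subspace_def matrix_vector_right_distrib vector_scalar_commute)
  have span_I: "vec.span ?I = ?I"
    using I by simp
  have "inj_on g (vec.span ?I)"
    unfolding span_I using inv by (rule inj_on_inverseI)
  then have dim_gI: "vec.dim (g ` ?I) = vec.dim ?I"
    by (rule vec.dim_image_eq[OF lg])
  have g0: "g 0 = 0"
    using lg by (rule vec.linear_0)
  have "x \<in> {x + y |x y. x \<in> ?K \<and> y \<in> g ` ?I}" if "x \<in> S" for x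
  proof -
    have "x - g (A *v x) \<in> ?K"
      using that g S inv by (auto simp: matrix_vector_mult_diff_distrib intro!: vec.subspace_diff)
    with that show ?thesis
      by (intro CollectI exI[of _ "x - g (A *v x)"] exI[of _ "g (A *v x)"]) auto
  qed
  then have sum: "{x + y |x y. x \<in> ?K \<and> y \<in> g ` ?I} = S"
    using g S by (auto intro: vec.subspace_add)
  \<comment> \<open>If \<open>g v\<close> is killed by \<open>A\<close> with \<open>v\<close> in the
    image, then \<open>v = A *v g v = 0\<close>, hence \<open>g v = g 0 = 0\<close>.\<close>
  have "?K \<inter> g ` ?I \<subseteq> {0}"
    using inv g0 by auto
  then have "vec.dim (?K \<inter> g ` ?I) = 0"
    by simp
  with vec.dim_sums_Int[OF K gI] show ?thesis
    unfolding sum dim_gI by linarith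
qed

text \<open>A right inverse of \<open>D\<close> on its range picks preimages linearly, so its matrix
  times \<open>E\<close> serves as \<open>X\<close>.\<close>

lemma matrix_factor_through:
  fixes E :: "'a::field ^ 'p ^ 'n" and D :: "'a ^ 'q ^ 'n"
  assumes "range ((*v) E) \<subseteq> range ((*v) D)"
  obtains X :: "'a ^ 'p ^ 'q" where "E = D ** X"
proof -
  obtain g where lg: "Vector_Spaces.linear (*s) (*s) g"
    and inv: "\<And>v. v \<in> range ((*v) D) \<Longrightarrow> D *v g v = v"
    using vec.linear_exists_right_inverse_on[OF matrix_vector_mul_linear_gen vec.subspace_UNIV, of D]
    by blast
  have "D *v g (E *v x) = E *v x" for x
    using assms by (intro inv) blast
  then have "E = D ** (matrix g ** E)"
    by (simp add: matrix_eq matrix_works[OF lg] flip: matrix_vector_mul_assoc)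
  then show thesis
    by (rule that)
qed

text \<open>The theorem with column spaces in place of row spaces; it is later applied to the
  transposed matrices.\<close>

lemma dim_range_product_eq_iff:
  fixes A :: "'a::field ^ 'n ^ 'm"
    and B :: "'a ^ 'p ^ 'n"
    and C :: "'a ^ 'q ^ 'p"
  shows "vec.dim (range ((*v) (A ** B ** C))) + vec.dim (range ((*v) B))
      = vec.dim (range ((*v) (A ** B))) + vec.dim (range ((*v) (B ** C))) \<longleftrightarrow>
    (\<exists>(X :: 'a ^ 'p ^ 'q) (Y :: 'a ^ 'm ^ 'n). B = B ** C ** X + Y ** A ** B)"
    (is "?dims \<longleftrightarrow> ?ex")
proof -
  let ?ker = "{x. A *v x = 0}"
  let ?S = "range ((*v) B) \<inter> ?ker" and ?T = "range ((*v) (B ** C)) \<inter> ?ker"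
  have sub: "vec.subspace (range ((*v) M))" for M :: "'a ^ 'k ^ 'l"
    by (simp add: range_matrix_vector_mult)
  have im: "range ((*v) (A ** M)) = (*v) A ` range ((*v) M)" for M :: "'a ^ 'k ^ 'n"
    by (auto simp: matrix_vector_mul_assoc[symmetric] image_iff)
  have ker: "vec.subspace ?ker"
    by (auto simp: vec.subspace_def matrix_vector_right_distrib vector_scalar_commute)
  have TS: "?T \<subseteq> ?S"
    by (auto simp: matrix_vector_mul_assoc[symmetric])
  \<comment> \<open>By rank-nullity, \<open>?S\<close> and \<open>?T\<close> measure the drop in
    dimension when \<open>A\<close> is applied to the ranges of \<open>B\<close> and
    \<open>B ** C\<close>; \<open>?dims\<close> says that both drops agree.\<close>
  have "?dims \<longleftrightarrow> vec.dim ?S = vec.dim ?T"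
    using dim_image_kernel[OF sub[of B], of A] dim_image_kernel[OF sub[of "B ** C"], of A]
    by (simp add: im matrix_mul_assoc[symmetric])
  also have "\<dots> \<longleftrightarrow> ?S \<subseteq> ?T"
  proof
    assume "vec.dim ?S = vec.dim ?T"
    then have "?T = ?S"
      by (intro vec.subspace_dim_equal vec.subspace_inter sub ker TS) simp
    then show "?S \<subseteq> ?T"
      by (rule equalityD2)
  next
    assume "?S \<subseteq> ?T"
    then show "vec.dim ?S = vec.dim ?T"
      using TS by (rule arg_cong[OF subset_antisym])
  qed
  also have "\<dots> \<longleftrightarrow> ?ex"
  proof
    assume ST: "?S \<subseteq> ?T"
    \<comment> \<open>The matrix of \<open>g\<close> is the generalised inverse \<open>G\<close>,
      since \<open>inv\<close> gives \<open>A B G A B = A B\<close>. The witness for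
      \<open>Y\<close> will be \<open>B G\<close>.\<close>
    obtain g where lg: "Vector_Spaces.linear (*s) (*s) g"
      and inv: "\<And>v. v \<in> range ((*v) (A ** B)) \<Longrightarrow> (A ** B) *v g v = v"
      using vec.linear_exists_right_inverse_on[OF matrix_vector_mul_linear_gen vec.subspace_UNIV, of "A ** B"]
      by blast
    define E where "E = B - B ** matrix g ** A ** B"
    have E: "E *v x = B *v (x - g ((A ** B) *v x))" for x
      by (simp add: E_def matrix_vector_mult_diff_rdistrib matrix_vector_mult_diff_distrib
          matrix_vector_mul_assoc[symmetric] matrix_works[OF lg])
    have "A *v (E *v x) = 0" for x
      using inv[of "(A ** B) *v x"]
      by (simp add: E matrix_vector_mult_diff_distrib matrix_vector_mul_assoc)
    then have "range ((*v) E) \<subseteq> ?S"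
      by (auto simp: E)
    with ST have "range ((*v) E) \<subseteq> range ((*v) (B ** C))"
      by blast
    then obtain X where "E = B ** C ** X"
      by (rule matrix_factor_through)
    then have "B = B ** C ** X + B ** matrix g ** A ** B"
      by (simp add: E_def algebra_simps)
    then show ?ex
      by blast
  next
    assume ?ex
    then obtain X :: "'a ^ 'p ^ 'q" and Y :: "'a ^ 'm ^ 'n" where XY: "B = B ** C ** X + Y ** A ** B"
      by blast
    \<comment> \<open>On such \<open>x\<close> the summand \<open>Y ** A ** B\<close> vanishes, so
      \<open>B *v x\<close> is in the range of \<open>B ** C\<close>.\<close>
    have "B *v x = (B ** C) *v (X *v x)" if "A *v (B *v x) = 0" for x
      using arg_cong[OF XY, of "\<lambda>M. M *v x"] that
      by (simp add: matrix_vector_mult_add_rdistrib matrix_vector_mul_assoc[symmetric])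
    then show "?S \<subseteq> ?T"
      by auto
  qed
  finally show ?thesis .
qed

theorem theorem6:
  fixes A :: "'a::field ^ 'n ^ 'm"
    and B :: "'a ^ 'p ^ 'n"
    and C :: "'a ^ 'q ^ 'p"
  shows "rank (A ** B ** C) + rank B = rank (A ** B) + rank (B ** C) \<longleftrightarrow>
    (\<exists>(X :: 'a ^ 'p ^ 'q) (Y :: 'a ^ 'm ^ 'n). B = B ** C ** X + Y ** A ** B)"
proof -
  have transpose_add: "transpose (M + N) = transpose M + transpose N" for M N :: "'a ^ 'p ^ 'n"
    by (simp add: transpose_def vec_eq_iff)
  \<comment> \<open>Transposition reverses products, so the right factor \<open>Y'\<close> and the
    left factor \<open>X'\<close> trade sides.\<close>
  have eq: "transpose B = transpose B ** transpose A ** Y' + X' ** transpose C ** transpose B \<longleftrightarrow>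
      B = B ** C ** transpose X' + transpose Y' ** A ** B" for X' Y'
  proof -
    have "transpose (B ** C ** transpose X' + transpose Y' ** A ** B)
        = transpose B ** transpose A ** Y' + X' ** transpose C ** transpose B"
      by (simp add: transpose_add matrix_transpose_mul matrix_mul_assoc add.commute)
    then show ?thesis
      by (simp flip: transpose_iff[of B])
  qed
  have "rank (A ** B ** C) + rank B = rank (A ** B) + rank (B ** C) \<longleftrightarrow>
    (\<exists>Y' X'. transpose B = transpose B ** transpose A ** Y' + X' ** transpose C ** transpose B)"
    \<comment> \<open>The outer matrices swap roles, so the terms for \<open>A ** B\<close> and
      \<open>B ** C\<close> change places in the sum.\<close>
    using dim_range_product_eq_iff[of "transpose C" "transpose B" "transpose A"]
    by (simp add: rank_eq_dim_range_transpose matrix_transpose_mul matrix_mul_assoc add.commute)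
  also have "\<dots> \<longleftrightarrow> (\<exists>X Y. B = B ** C ** X + Y ** A ** B)"
  proof
    assume "\<exists>X Y. B = B ** C ** X + Y ** A ** B"
    then obtain X Y where "B = B ** C ** transpose (transpose X) + transpose (transpose Y) ** A ** B"
      by auto
    then show "\<exists>Y' X'. transpose B = transpose B ** transpose A ** Y' + X' ** transpose C ** transpose B"
      unfolding eq[symmetric] by blast
  qed (auto simp only: eq)
  finally show ?thesis .
qed

end
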